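(* Let $G=(V,E)$ be a finite simple graph all of whose vertex degrees satisfy $z_v\le z_0$, where $z_0$ is a fixed integer. Consider the discrete Laplacian model on $G$ with minimal local constraints $M_v=z_v$ for all $v\in V$, evolving by a reversible Markov process. Then for every vertex $v\in V$ the time-averaged infinite-temperature autocorrelation satisfies $$\overline{C_v}\;\ge\;\Big(\frac{z_v}{2}\Big)^2 (z_0+1)^{-2z_0}.$$ In particular, the time-averaged infinite-temperature autocorrelations remain finite (bounded below by a positive constant independent of the size of the graph) in the thermodynamic limit $|V|\to\infty$ at fixed $z_0$, $z_v\geq 1$.
   Context: Discrete Laplacian model with minimal constraints. For $v\in V$ let $\mathcal N_v$ be its set of neighbors and $z_v=|\mathcal N_v|$ its degree. A configuration is $\mathbf m=(m_v)_{v\in V}$ with integers $0\le m_v\le M_v$, where $M_v=z_v$; the total number of configurations is $D=\prod_{v}(z_v+1)$. There are two elementary updates at a vertex $v$: $v$ *fires*: $m_v\mapsto m_v-z_v$ and $m_{v'}\mapsto m_{v'}+1$ for all $v'\in\mathcal N_v$; $v$ *anti-fires*: the inverse, $m_v\mapsto m_v+z_v$ and $m_{v'}\mapsto m_{v'}-1$ for all $v'\in\mathcal N_v$. An update is allowed only if the resulting configuration satisfies $0\le m_w\le z_w$ for all $w\in V$. Dynamics. A stochastic evolution in discrete time is a Markov chain on configurations with transition matrix $T$, in which at each integer time a (possibly empty, random) collection of allowed firings/anti-firings acting on pairwise disjoint sets $\{v\}\cup\mathcal N_v$ is applied. It is reversible in the sense $T_{\mathbf m,\mathbf m'}=T_{\mathbf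 m',\mathbf m}$. The configuration space decomposes into connected components under the dynamics, and the chain is irreducible on each component. Correlations. Let $\langle m_v(t)\rangle_{\mathbf m(0)}$ be the expectation of $m_v$ at time $t$ starting from $\mathbf m(0)$. The infinite-temperature connected autocorrelation is $$C_v(t)=\frac1D\sum_{\mathbf m(0)} m_v(0)\,\langle m_v(t)\rangle_{\mathbf m(0)}-\Big(\frac1D\sum_{\mathbf m(0)}m_v(0)\Big)\Big(\frac1D\sum_{\mathbf m(0)}\langle m_v(t)\rangle_{\mathbf m(0)}\Big),$$ where the sums run over all $D$ configurations, and $\overline{C_v}=\lim_{\tau\to\infty}\frac1\tau\sum_{t=0}^{\tau}C_v(t)$. *)

theory Defs
  imports "HOL-Probability.Probability" "Graph_Theory.Pair_Digraph"
begin

text \<open>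
  Finite simple graphs are the locale \<^locale>\<open>pair_graph\<close>: finite vertex set, symmetric and
  loop-free arc relation, hence every undirected edge is present as a pair of opposite arcs.
\<close>

definition nbrs :: "'a pair_pre_digraph \<Rightarrow> 'a \<Rightarrow> 'a set" where
  "nbrs G v = {w. (v, w) \<in> parcs G}"

definition deg :: "'a pair_pre_digraph \<Rightarrow> 'a \<Rightarrow> nat" where
  "deg G v = card (nbrs G v)"

text \<open>
  Configurations live on the vertex set only: they are extensional functions (\<open>undefined\<close>
  off the vertices), so that distinct configurations differ at a vertex.
\<close>

type_synonym 'a config = "'a \<Rightarrow> int"

definition configs :: "'a pair_pre_digraph \<Rightarrow> 'a config set" where
  "configs G = (\<Pi>\<^sub>E v\<in>pverts G. {0..int (deg G v)})"

definition num_configs :: "'a pair_pre_digraph \<Rightarrow> nat" where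
  "num_configs G = (\<Prod>v\<in>pverts G. deg G v + 1)"

lemma card_configs: "pair_graph G \<Longrightarrow> card (configs G) = num_configs G"
proof -
  assume "pair_graph G"
  then interpret pair_graph G .
  show ?thesis
    unfolding configs_def num_configs_def using pair_finite_verts
    by (subst card_PiE) (auto intro!: prod.cong)
qed

datatype 'a update = Fire (site: 'a) | Antifire (site: 'a)

fun increment :: "'a pair_pre_digraph \<Rightarrow> 'a update \<Rightarrow> 'a \<Rightarrow> int" where
  "increment G (Fire v) w =
     (if w = v then - int (deg G v) else if w \<in> nbrs G v then 1 else 0)"
| "increment G (Antifire v) w =
     (if w = v then int (deg G v) else if w \<in> nbrs G v then - 1 else 0)"

definition apply_updates :: "'a pair_pre_digraph \<Rightarrow> 'a update set \<Rightarrow> 'a config \<Rightarrow> 'a config" where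
  "apply_updates G S m = (\<lambda>w\<in>pverts G. m w + (\<Sum>u\<in>S. increment G u w))"

definition allowed :: "'a pair_pre_digraph \<Rightarrow> 'a config \<Rightarrow> 'a update \<Rightarrow> bool" where
  "allowed G m u \<longleftrightarrow> site u \<in> pverts G \<and> apply_updates G {u} m \<in> configs G"

definition support :: "'a pair_pre_digraph \<Rightarrow> 'a update \<Rightarrow> 'a set" where
  "support G u = insert (site u) (nbrs G (site u))"

definition allowed_collection :: "'a pair_pre_digraph \<Rightarrow> 'a config \<Rightarrow> 'a update set \<Rightarrow> bool" where
  "allowed_collection G m S \<longleftrightarrow>
     (\<forall>u\<in>S. allowed G m u) \<and> disjoint_family_on (support G) S"

text \<open>
  A chain is given by its transition kernel \<open>T\<close>; the entry \<open>T\<^bsub>m,m'\<^esub>\<close> of the transition matrix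
  is \<open>pmf (T m) m'\<close>. Values of \<open>T\<close> outside the configurations are irrelevant.
\<close>

primrec law :: "('s \<Rightarrow> 's pmf) \<Rightarrow> nat \<Rightarrow> 's \<Rightarrow> 's pmf" where
  "law T 0 m = return_pmf m"
| "law T (Suc t) m = bind_pmf (law T t m) T"

definition transitions :: "'a pair_pre_digraph \<Rightarrow> ('a config \<Rightarrow> 'a config pmf) \<Rightarrow> 'a config rel" where
  "transitions G T = {(m, m'). m \<in> configs G \<and> m' \<in> configs G \<and> pmf (T m) m' > 0}"

definition component ::
  "'a pair_pre_digraph \<Rightarrow> ('a config \<Rightarrow> 'a config pmf) \<Rightarrow> 'a config \<Rightarrow> 'a config set" where
  "component G T m = (transitions G T \<union> (transitions G T)\<inverse>)\<^sup>* `` {m}"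

locale laplacian_chain = pair_graph G
  for G :: "'a pair_pre_digraph" +
  fixes T :: "'a config \<Rightarrow> 'a config pmf"
  assumes random_updates:
    "m \<in> configs G \<Longrightarrow>
       \<exists>P :: 'a update set pmf. set_pmf P \<subseteq> {S. allowed_collection G m S} \<and>
         T m = map_pmf (\<lambda>S. apply_updates G S m) P"
  and reversible:
    "m \<in> configs G \<Longrightarrow> m' \<in> configs G \<Longrightarrow> pmf (T m) m' = pmf (T m') m"
  and irreducible_on_components:
    "m \<in> configs G \<Longrightarrow> m' \<in> component G T m \<Longrightarrow> \<exists>t. pmf (law T t m) m' > 0"

text \<open>
  Components being those of the chain itself, irreducibility on each of them already follows
  from the symmetry of the transition matrix, so this assumption excludes no chain.
\<close>

lemma symmetric_irreducible_on_components:
  assumes sym: "\<And>m m'. m \<in> configs G \<Longrightarrow> m' \<in> configs G \<Longrightarrow> pmf (T m) m' = pmf (T m') m"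
    and "m' \<in> component G T m"
  shows "\<exists>t. pmf (law T t m) m' > 0"
proof -
  have "(m, m') \<in> (transitions G T \<union> (transitions G T)\<inverse>)\<^sup>*"
    using assms(2) by (simp add: component_def)
  then show ?thesis
  proof (induction rule: rtrancl_induct)
    case base
    have "pmf (law T 0 m) m > 0" by simp
    then show ?case by blast
  next
    case (step y z)
    then obtain t where "pmf (law T t m) y > 0" by blast
    moreover have "pmf (T y) z > 0"
      using step.hyps(2) sym by (auto simp: transitions_def)
    ultimately have "z \<in> set_pmf (law T (Suc t) m)"
      by (auto simp: set_bind_pmf pmf_positive_iff)
    then show ?case by (auto simp: pmf_positive_iff simp del: law.simps)
  qed
qed

definition mean_at ::
  "('a config \<Rightarrow> 'a config pmf) \<Rightarrow> 'a \<Rightarrow> nat \<Rightarrow> 'a config \<Rightarrow> real" where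
  "mean_at T v t m = measure_pmf.expectation (law T t m) (\<lambda>m'. real_of_int (m' v))"

definition autocorr ::
  "'a pair_pre_digraph \<Rightarrow> ('a config \<Rightarrow> 'a config pmf) \<Rightarrow> 'a \<Rightarrow> nat \<Rightarrow> real" where
  "autocorr G T v t =
     1 / real (num_configs G) * (\<Sum>m\<in>configs G. real_of_int (m v) * mean_at T v t m)
     - (1 / real (num_configs G) * (\<Sum>m\<in>configs G. real_of_int (m v)))
       * (1 / real (num_configs G) * (\<Sum>m\<in>configs G. mean_at T v t m))"

definition autocorr_avg ::
  "'a pair_pre_digraph \<Rightarrow> ('a config \<Rightarrow> 'a config pmf) \<Rightarrow> 'a \<Rightarrow> nat \<Rightarrow> real" where
  "autocorr_avg G T v \<tau> = 1 / real \<tau> * (\<Sum>t=0..\<tau>. autocorr G T v t)"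

definition time_avg_autocorr ::
  "'a pair_pre_digraph \<Rightarrow> ('a config \<Rightarrow> 'a config pmf) \<Rightarrow> 'a \<Rightarrow> real" where
  "time_avg_autocorr G T v = lim (autocorr_avg G T v)"

end

theory Submission
  imports Defs
begin

text \<open>
  Write \<open>c\<close> for the deviation of the full value of \<open>m\<^sub>v\<close> from its mean, \<open>c = deg v / 2\<close>. If \<open>w\<close> is
  a neighbor of \<open>v\<close> and all vertices of \<open>F = N\<^sub>v \<union> N\<^sub>w\<close> (which contains \<open>v\<close> and \<open>w\<close>) are
  full, then no vertex of \<open>F\<close> is ever updated: firing is blocked by the full center adjacent to it,
  and anti-firing would require all of its neighbors, one of which is in \<open>F\<close>, to contribute \<open>deg\<close>
  anti-firings in total, whereas the neighbor of an idle vertex anti-fires at most once (net). So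
  \<open>m\<^sub>v\<close> is constant on a closed set \<open>B\<close> of configurations of density at least
  \<open>(z0 + 1)\<close> to the power \<open>- 2 z0\<close>, as \<open>F\<close> has at most \<open>2 z0\<close> elements. The closed set \<open>B\<close>
  contributes \<open>c\<^sup>2\<close> times its density to every autocorrelation, and the time average of the
  contribution of its complement converges to a nonnegative number.
\<close>

section \<open>Averages over symmetric chains\<close>

lemma average_null_sequence:
  fixes e :: "nat \<Rightarrow> real"
  assumes "e \<longlonglongrightarrow> 0"
  shows "(\<lambda>n. 1 / real n * (\<Sum>t=0..n. e t)) \<longlonglongrightarrow> 0"
proof (rule LIMSEQ_I)
  fix r :: real assume "r > 0"
  then obtain N where N: "\<And>t. t \<ge> N \<Longrightarrow> \<bar>e t\<bar> < r / 2"
    using LIMSEQ_D[OF assms, of "r / 2"] by auto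
  define M where "M = (\<Sum>t=0..N. \<bar>e t\<bar>)"
  have "M \<ge> 0" by (simp add: M_def sum_nonneg)
  \<comment> \<open>From \<open>K\<close> on, the fixed head \<open>M\<close> stays below
    \<open>n * r / 2\<close>, half of the allowance; the tail takes the other half.\<close>
  obtain K :: nat where K: "2 * M / r < real K" using reals_Archimedean2 by blast
  show "\<exists>no. \<forall>n\<ge>no. norm (1 / real n * (\<Sum>t=0..n. e t) - 0) < r"
  proof (intro exI allI impI)
    fix n assume n: "n \<ge> max (Suc N) K"
    have "n > 0" using n by auto
    have "\<bar>\<Sum>t=0..n. e t\<bar> \<le> (\<Sum>t=0..n. \<bar>e t\<bar>)" by simp
    also have "\<dots> = M + (\<Sum>t=Suc N..n. \<bar>e t\<bar>)"
    proof -
      obtain p where "n = N + p" using that[of "n - N"] n by simp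
      then show ?thesis by (simp add: M_def sum.ub_add_nat[of 0 N "\<lambda>t. \<bar>e t\<bar>" p])
    qed
    also have "(\<Sum>t=Suc N..n. \<bar>e t\<bar>) \<le> (\<Sum>t=Suc N..n. r / 2)"
      by (intro sum_mono less_imp_le N) auto
    also have "\<dots> \<le> real n * (r / 2)"
      using \<open>r > 0\<close> by (auto intro!: mult_right_mono)
    finally have "\<bar>\<Sum>t=0..n. e t\<bar> \<le> M + real n * (r / 2)" by simp
    also have "M < real n * (r / 2)"
    proof -
      have "2 * M / r < real n" using K n by linarith
      then show ?thesis using \<open>r > 0\<close> by (simp add: field_simps)
    qed
    finally show "norm (1 / real n * (\<Sum>t=0..n. e t) - 0) < r"
      using \<open>n > 0\<close> by (simp add: field_simps abs_mult)
  qed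
qed

text \<open>As in \<open>autocorr_avg\<close>, there are \<open>n + 1\<close> terms but the divisor
  is \<open>n\<close>, so the constant part contributes \<open>L + L / n\<close>, and the excess
  vanishes.\<close>

lemma average_tendsto:
  fixes c :: "nat \<Rightarrow> real"
  assumes "c \<longlonglongrightarrow> L"
  shows "(\<lambda>n. 1 / real n * (\<Sum>t=0..n. c t)) \<longlonglongrightarrow> L"
proof -
  have "(\<lambda>n. 1 / real n * (\<Sum>t=0..n. c t - L)) \<longlonglongrightarrow> 0"
    by (rule average_null_sequence) (use assms in \<open>simp add: LIM_zero\<close>)
  from tendsto_add[OF this tendsto_add[OF tendsto_const tendsto_mult[OF tendsto_const lim_1_over_n]]]
  have "(\<lambda>n. 1 / real n * (\<Sum>t=0..n. c t - L) + (L + L * (1 / real n))) \<longlonglongrightarrow> L"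
    by (simp only: mult_zero_right add_0_left add_0_right)
  moreover have "\<forall>\<^sub>F n in sequentially.
      1 / real n * (\<Sum>t=0..n. c t - L) + (L + L * (1 / real n)) = 1 / real n * (\<Sum>t=0..n. c t)"
    using eventually_gt_at_top[of 0]
    by eventually_elim (simp add: sum_subtractf field_simps)
  ultimately show ?thesis by (rule Lim_transform_eventually)
qed

section \<open>Evolution operator of a symmetric stochastic kernel\<close>

locale symmetric_kernel =
  fixes S :: "'s set" and K :: "'s \<Rightarrow> 's \<Rightarrow> real"
  assumes finite_space: "finite S"
    and kernel_nonneg: "K x y \<ge> 0"
    and kernel_sym: "x \<in> S \<Longrightarrow> y \<in> S \<Longrightarrow> K x y = K y x"
    and kernel_sum: "x \<in> S \<Longrightarrow> (\<Sum>y\<in>S. K x y) = 1"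
begin

definition evolve :: "('s \<Rightarrow> real) \<Rightarrow> 's \<Rightarrow> real" where
  "evolve f x = (\<Sum>y\<in>S. K x y * f y)"

text \<open>Unweighted because symmetry makes the counting measure stationary; \<open>evolve\<close>
  is self-adjoint for this product.\<close>

definition ip :: "('s \<Rightarrow> real) \<Rightarrow> ('s \<Rightarrow> real) \<Rightarrow> real" where
  "ip f g = (\<Sum>x\<in>S. f x * g x)"

lemma evolve_selfadjoint: "ip (evolve f) g = ip f (evolve g)"
proof -
  have "ip (evolve f) g = (\<Sum>x\<in>S. \<Sum>y\<in>S. K x y * f y * g x)"
    by (simp add: ip_def evolve_def sum_distrib_right)
  also have "\<dots> = (\<Sum>y\<in>S. \<Sum>x\<in>S. K x y * f y * g x)"
    by (rule sum.swap)
  also have "\<dots> = (\<Sum>y\<in>S. \<Sum>x\<in>S. f y * (K y x * g x))"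
    by (intro sum.cong refl) (simp add: kernel_sym)
  finally show ?thesis by (simp add: ip_def evolve_def sum_distrib_left)
qed

lemma evolve_power_selfadjoint: "ip ((evolve ^^ n) f) g = ip f ((evolve ^^ n) g)"
proof (induction n arbitrary: g)
  case (Suc n)
  then show ?case by (simp add: evolve_selfadjoint) (simp add: funpow_swap1)
qed simp

lemma ip_evolve_power_add: "ip ((evolve ^^ i) f) ((evolve ^^ j) f) = ip f ((evolve ^^ (i + j)) f)"
  by (simp add: evolve_power_selfadjoint funpow_add)

text \<open>The squares \<open>(f x + s * f y)\<^sup>2\<close>, weighted by \<open>K x y\<close> and
  summed over all pairs, give twice this expression. The two signs together confine the spectrum of
  \<open>evolve\<close> to \<open>[-1, 1]\<close>.\<close>

lemma ip_evolve_bounded: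
  assumes "s = 1 \<or> s = (- 1 :: real)"
  shows "0 \<le> ip f f + s * ip f (evolve f)"
proof -
  have sq: "(\<Sum>x\<in>S. \<Sum>y\<in>S. K x y * (f x)\<^sup>2) = ip f f"
    by (simp add: ip_def sum_distrib_right[symmetric] kernel_sum power2_eq_square)
  have "(\<Sum>x\<in>S. \<Sum>y\<in>S. K x y * (f y)\<^sup>2) = (\<Sum>y\<in>S. \<Sum>x\<in>S. K x y * (f y)\<^sup>2)"
    by (rule sum.swap)
  also have "\<dots> = (\<Sum>y\<in>S. \<Sum>x\<in>S. K y x * (f y)\<^sup>2)"
    by (intro sum.cong refl) (simp add: kernel_sym)
  finally have sq': "(\<Sum>x\<in>S. \<Sum>y\<in>S. K x y * (f y)\<^sup>2) = ip f f" using sq by simp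
  have cross: "(\<Sum>x\<in>S. \<Sum>y\<in>S. K x y * (f x * f y)) = ip f (evolve f)"
    by (simp add: ip_def evolve_def sum_distrib_left algebra_simps)
  have "s\<^sup>2 = 1" using assms by auto
  then have "K x y * (f x + s * f y)\<^sup>2 =
      K x y * (f x)\<^sup>2 + K x y * (f y)\<^sup>2 + 2 * s * (K x y * (f x * f y))" for x y
    by (simp add: power2_sum power_mult_distrib algebra_simps)
  then have "(\<Sum>x\<in>S. \<Sum>y\<in>S. K x y * (f x + s * f y)\<^sup>2) = 2 * (ip f f + s * ip f (evolve f))"
    by (simp add: sum.distrib sq sq' cross sum_distrib_left[symmetric])
  moreover have "(\<Sum>x\<in>S. \<Sum>y\<in>S. K x y * (f x + s * f y)\<^sup>2) \<ge> 0"
    by (intro sum_nonneg mult_nonneg_nonneg kernel_nonneg) auto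
  ultimately show ?thesis by simp
qed

text \<open>
  With \<open>P\<close> the evolution operator, \<open>g = P\<^sup>t f\<close> and \<open>h = g + s P g\<close> for a sign \<open>s\<close>, this inequality
  reads \<open>\<langle>h, h\<rangle> - s \<langle>h, P h\<rangle> \<ge> 0\<close>. The two signs together give the monotonicity of the even
  autocorrelations, and \<open>s = 1\<close> gives that of the sums over consecutive pairs, so that the averages
  converge without any appeal to the spectral theorem.
\<close>

lemma autocorrelation_difference_nonneg:
  fixes s :: real and f :: "'s \<Rightarrow> real"
  defines "a \<equiv> \<lambda>t. ip f ((evolve ^^ t) f)"
  assumes s: "s = 1 \<or> s = - 1"
  shows "0 \<le> a (2 * t) + s * a (2 * t + 1) - a (2 * t + 2) - s * a (2 * t + 3)"
proof -
  have a_add: "ip ((evolve ^^ i) f) ((evolve ^^ j) f) = a (i + j)" for i j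
    by (simp add: a_def ip_evolve_power_add)
  define g where "g = (evolve ^^ t) f"
  define p where "p = evolve g"
  define q where "q = evolve p"
  define h where "h = (\<lambda>x. g x + s * p x)"
  have "evolve h x = evolve g x + s * evolve p x" for x
    unfolding h_def evolve_def by (simp add: sum.distrib sum_distrib_left algebra_simps)
  then have e: "evolve h = (\<lambda>x. p x + s * q x)"
    by (simp add: p_def q_def fun_eq_iff)
  have pt: "p = (evolve ^^ Suc t) f" and qt: "q = (evolve ^^ Suc (Suc t)) f"
    by (simp_all add: p_def q_def g_def)
  have vals: "ip g g = a (2 * t)" "ip g p = a (2 * t + 1)" "ip p p = a (2 * t + 2)"
    "ip g q = a (2 * t + 2)" "ip p q = a (2 * t + 3)"
    unfolding g_def pt qt a_add by (simp_all add: mult_2 numeral_3_eq_3)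
  have ss: "s * s = 1" using s by auto
  have "ip h h = ip g g + 2 * s * ip g p + (s * s) * ip p p"
    by (simp add: h_def ip_def sum.distrib sum_distrib_left algebra_simps)
  moreover have "s * ip h (evolve h) = s * ip g p + (s * s) * ip g q + (s * s) * ip p p + (s * s) * (s * ip p q)"
    unfolding e by (simp add: h_def ip_def sum.distrib sum_distrib_left algebra_simps)
  moreover have "0 \<le> ip h h + (- s) * ip h (evolve h)"
    by (rule ip_evolve_bounded) (use s in auto)
  ultimately show ?thesis
    unfolding ss vals by (simp add: algebra_simps)
qed

text \<open>The sequence \<open>a\<close> itself may oscillate with the parity of \<open>t\<close>
  (spectral value -1), but the sums of consecutive terms converge. Averaging \<open>a\<close> is
  averaging half of these sums, up to a bounded boundary term divided by \<open>n\<close>.\<close>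

lemma average_autocorrelation_tendsto_nonneg:
  "\<exists>L\<ge>0. (\<lambda>n. 1 / real n * (\<Sum>t=0..n. ip f ((evolve ^^ t) f))) \<longlonglongrightarrow> L"
proof -
  define a where "a t = ip f ((evolve ^^ t) f)" for t
  have even_pos: "0 \<le> a (2 * t)" for t
  proof -
    have "a (2 * t) = ip ((evolve ^^ t) f) ((evolve ^^ t) f)"
      by (simp add: a_def ip_evolve_power_add mult_2)
    also have "\<dots> \<ge> 0" by (simp add: ip_def sum_nonneg)
    finally show ?thesis .
  qed
  have pair_pos: "0 \<le> a (2 * t) + a (2 * t + 1)" for t
  proof -
    have "0 \<le> ip ((evolve ^^ t) f) ((evolve ^^ t) f) + 1 * ip ((evolve ^^ t) f) (evolve ((evolve ^^ t) f))"
      by (rule ip_evolve_bounded) simp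
    also have "\<dots> = ip ((evolve ^^ t) f) ((evolve ^^ t) f) + ip ((evolve ^^ t) f) ((evolve ^^ Suc t) f)"
      by simp
    also have "\<dots> = a (2 * t) + a (2 * t + 1)"
      unfolding a_def ip_evolve_power_add by (simp add: mult_2)
    finally show ?thesis .
  qed
  have diff: "0 \<le> a (2 * t) + a (2 * t + 1) - a (2 * t + 2) - a (2 * t + 3)"
    "0 \<le> a (2 * t) - a (2 * t + 1) - a (2 * t + 2) + a (2 * t + 3)" for t
    using autocorrelation_difference_nonneg[of 1 f t] autocorrelation_difference_nonneg[of "- 1" f t]
    by (simp_all add: a_def)
  \<comment> \<open>The two inequalities of \<open>diff\<close> add up to this monotonicity.\<close>
  have dec_even: "decseq (\<lambda>t. a (2 * t))"
  proof (rule decseq_SucI)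
    fix t show "a (2 * Suc t) \<le> a (2 * t)" using diff[of t] by simp
  qed
  then obtain \<alpha> where \<alpha>: "(\<lambda>t. a (2 * t)) \<longlonglongrightarrow> \<alpha>"
    using decseq_convergent even_pos by blast
  have dec_pair: "decseq (\<lambda>t. a (2 * t) + a (2 * t + 1))"
  proof (rule decseq_SucI)
    fix t show "a (2 * Suc t) + a (2 * Suc t + 1) \<le> a (2 * t) + a (2 * t + 1)"
      using diff(1)[of t] by (simp add: numeral_3_eq_3)
  qed
  then obtain \<pi> where \<pi>: "(\<lambda>t. a (2 * t) + a (2 * t + 1)) \<longlonglongrightarrow> \<pi>"
    using decseq_convergent pair_pos by blast
  have "\<pi> \<ge> 0"
    by (rule LIMSEQ_le_const[OF \<pi>]) (use pair_pos in blast)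
  have "(\<lambda>t. (a (2 * t) + a (2 * t + 1)) - a (2 * t)) \<longlonglongrightarrow> \<pi> - \<alpha>"
    by (intro tendsto_intros \<alpha> \<pi>)
  then have odd: "(\<lambda>t. a (2 * t + 1)) \<longlonglongrightarrow> \<pi> - \<alpha>" by simp
  \<comment> \<open>Pairs starting at an odd time have the same limit: the parity-dependent
    \<open>\<alpha>\<close> cancels.\<close>
  have "(\<lambda>t. a (2 * t + 1) + a (2 * Suc t)) \<longlonglongrightarrow> (\<pi> - \<alpha>) + \<alpha>"
    by (rule tendsto_add[OF odd LIMSEQ_Suc[OF \<alpha>]])
  then have odd_pair: "(\<lambda>t. a (2 * t + 1) + a (Suc (2 * t + 1))) \<longlonglongrightarrow> \<pi>" by simp
  have even_pair: "(\<lambda>t. a (2 * t) + a (Suc (2 * t))) \<longlonglongrightarrow> \<pi>"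
    using \<pi> by simp
  have "(\<lambda>t. a t + a (Suc t)) \<longlonglongrightarrow> \<pi>"
    by (rule limseq_even_odd[of "\<lambda>t. a t + a (Suc t)", OF even_pair odd_pair])
  then have "(\<lambda>t. (a t + a (Suc t)) / 2) \<longlonglongrightarrow> \<pi> / 2"
    by (intro tendsto_divide) simp_all
  then have avg: "(\<lambda>n. 1 / real n * (\<Sum>t=0..n. (a t + a (Suc t)) / 2)) \<longlonglongrightarrow> \<pi> / 2"
    by (rule average_tendsto)
  define C where "C = \<bar>a 0\<bar> + \<bar>a 1\<bar>"
  \<comment> \<open>Even terms lie in \<open>[0, a 0]\<close> and pair sums in
    \<open>[0, a 0 + a 1]\<close>; the difference controls the odd terms.\<close>
  have bound: "\<bar>a t\<bar> \<le> C" for t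
  proof -
    have "a (2 * k) \<le> a 0" for k
      using decseqD[OF dec_even, of 0 k] by simp
    moreover have "a (2 * k) + a (2 * k + 1) \<le> a 0 + a 1" for k
      using decseqD[OF dec_pair, of 0 k] by simp
    ultimately have "\<bar>a (2 * k)\<bar> \<le> C \<and> \<bar>a (2 * k + 1)\<bar> \<le> C" for k
      using even_pos[of k] pair_pos[of k] unfolding C_def
      by (smt (verit, best))
    then show ?thesis by (cases "even t") (auto elim!: evenE oddE)
  qed
  \<comment> \<open>This is the boundary term left when each \<open>a t\<close> is replaced by
    \<open>(a t + a (Suc t)) / 2\<close>.\<close>
  have "(\<lambda>n. 1 / real n * (a 0 / 2 - a (Suc n) / 2)) \<longlonglongrightarrow> 0"
  proof (rule Lim_null_comparison)
    show "\<forall>\<^sub>F n in sequentially. norm (1 / real n * (a 0 / 2 - a (Suc n) / 2)) \<le> C * (1 / real n)"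
    proof (intro always_eventually allI)
      fix n
      have "\<bar>a 0 / 2 - a (Suc n) / 2\<bar> \<le> C"
        using bound[of 0] bound[of "Suc n"] by linarith
      then show "norm (1 / real n * (a 0 / 2 - a (Suc n) / 2)) \<le> C * (1 / real n)"
        by (simp add: abs_mult divide_right_mono)
    qed
    show "(\<lambda>n. C * (1 / real n)) \<longlonglongrightarrow> 0"
      using tendsto_mult_right_zero[OF lim_1_over_n] by blast
  qed
  from tendsto_add[OF avg this] have "(\<lambda>n. 1 / real n * (\<Sum>t=0..n. (a t + a (Suc t)) / 2)
      + 1 / real n * (a 0 / 2 - a (Suc n) / 2)) \<longlonglongrightarrow> \<pi> / 2"
    by (simp only: add_0_right)
  also have "(\<lambda>n. 1 / real n * (\<Sum>t=0..n. (a t + a (Suc t)) / 2)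
      + 1 / real n * (a 0 / 2 - a (Suc n) / 2)) = (\<lambda>n. 1 / real n * (\<Sum>t=0..n. a t))"
  proof
    fix n
    have "(\<Sum>t=0..n. (a t + a (Suc t)) / 2) + (a 0 / 2 - a (Suc n) / 2) = (\<Sum>t=0..n. a t)"
      by (induction n) (simp_all add: field_simps)
    then show "1 / real n * (\<Sum>t=0..n. (a t + a (Suc t)) / 2)
      + 1 / real n * (a 0 / 2 - a (Suc n) / 2) = 1 / real n * (\<Sum>t=0..n. a t)"
      by (metis distrib_left)
  qed
  finally show ?thesis
    using \<open>\<pi> \<ge> 0\<close> unfolding a_def by (intro exI[of _ "\<pi> / 2"]) simp
qed

lemma evolve_power_minus_const:
  "x \<in> S \<Longrightarrow> (evolve ^^ t) (\<lambda>y. f y - c) x = (evolve ^^ t) f x - c"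
proof (induction t arbitrary: x)
  case (Suc t)
  have "(\<Sum>y\<in>S. K x y * c) = c"
    using Suc.prems by (simp add: sum_distrib_right[symmetric] kernel_sum)
  then show ?case
    using Suc by (simp add: evolve_def sum_subtractf right_diff_distrib)
qed simp

text \<open>Stationarity of the uniform distribution: self-adjointness moves the power onto the
  constant function 1, which is fixed because rows sum to 1.\<close>

lemma sum_evolve_power: "(\<Sum>x\<in>S. (evolve ^^ t) f x) = (\<Sum>x\<in>S. f x)"
proof -
  have "(evolve ^^ t) (\<lambda>_. 1) x = 1" if "x \<in> S" for x
    using that by (induction t arbitrary: x) (simp_all add: evolve_def kernel_sum)
  then have "ip f ((evolve ^^ t) (\<lambda>_. 1)) = (\<Sum>x\<in>S. f x)"
    by (simp add: ip_def)
  then show ?thesis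
    by (simp add: evolve_power_selfadjoint[symmetric]) (simp add: ip_def)
qed

text \<open>The evolution splits into independent parts on \<open>B\<close> and on its complement.
  On \<open>B\<close> the function stays equal to \<open>c\<close>; on the complement it evolves
  like \<open>f'\<close>, which is \<open>f\<close> set to zero on \<open>B\<close> and has a
  nonnegative average limit.\<close>

lemma average_autocorrelation_closed_set:
  fixes f :: "'s \<Rightarrow> real" and c :: real
  assumes "B \<subseteq> S"
    and closed: "\<And>x y. x \<in> B \<Longrightarrow> y \<in> S - B \<Longrightarrow> K x y = 0"
    and const: "\<And>x. x \<in> B \<Longrightarrow> f x = c"
  shows "\<exists>L \<ge> c\<^sup>2 * card B. (\<lambda>n. 1 / real n * (\<Sum>t=0..n. ip f ((evolve ^^ t) f))) \<longlonglongrightarrow> L"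
proof -
  define f' where "f' x = (if x \<in> B then 0 else f x)" for x
  have "finite B" using assms(1) finite_space finite_subset by blast
  have split: "evolve g x = (\<Sum>y\<in>B. K x y * g y) + (\<Sum>y\<in>S - B. K x y * g y)" for g x
    unfolding evolve_def using sum.subset_diff[OF assms(1) finite_space] by (simp add: add.commute)
  \<comment> \<open>By symmetry, a set that cannot be left cannot be entered either.\<close>
  have closed': "K x y = 0" if "x \<in> S - B" "y \<in> B" for x y
    using closed[of y x] kernel_sym[of x y] that assms(1) by auto
  have sumB: "(\<Sum>y\<in>B. K x y) = 1" if "x \<in> B" for x
    using kernel_sum[of x] split[of "\<lambda>_. 1" x] closed[of x] that assms(1)
    by (auto simp: evolve_def)
  have dyn: "(x \<in> B \<longrightarrow> (evolve ^^ t) f x = c \<and> (evolve ^^ t) f' x = 0) \<and>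
      (x \<in> S - B \<longrightarrow> (evolve ^^ t) f x = (evolve ^^ t) f' x)" for x t
  proof (induction t arbitrary: x)
    case 0
    then show ?case by (simp add: const f'_def)
  next
    case (Suc t)
    have "evolve ((evolve ^^ t) f) x = c" if "x \<in> B"
      using that Suc by (simp add: split[of "(evolve ^^ t) f"] split[of "(evolve ^^ t) f'"] closed sum_distrib_right[symmetric] sumB)
    moreover have "evolve ((evolve ^^ t) f') x = 0" if "x \<in> B"
      using that Suc by (simp add: split[of "(evolve ^^ t) f"] split[of "(evolve ^^ t) f'"] closed)
    moreover have "evolve ((evolve ^^ t) f) x = evolve ((evolve ^^ t) f') x" if "x \<in> S - B"
      using that Suc by (simp add: split[of "(evolve ^^ t) f"] split[of "(evolve ^^ t) f'"] closed')
    ultimately show ?case by simp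
  qed
  have ip_split: "ip g h = (\<Sum>x\<in>B. g x * h x) + (\<Sum>x\<in>S - B. g x * h x)" for g h
    unfolding ip_def using sum.subset_diff[OF assms(1) finite_space] by (simp add: add.commute)
  have dec: "ip f ((evolve ^^ t) f) = c\<^sup>2 * card B + ip f' ((evolve ^^ t) f')" for t
    using dyn by (simp add: ip_split const f'_def power2_eq_square)
  obtain L where "L \<ge> 0" "(\<lambda>n. 1 / real n * (\<Sum>t=0..n. ip f' ((evolve ^^ t) f'))) \<longlonglongrightarrow> L"
    using average_autocorrelation_tendsto_nonneg by blast
  moreover have "(\<lambda>n. 1 / real n * (\<Sum>t=0..n. c\<^sup>2 * card B)) \<longlonglongrightarrow> c\<^sup>2 * card B"
    by (rule average_tendsto) simp
  ultimately have "(\<lambda>n. 1 / real n * (\<Sum>t=0..n. ip f ((evolve ^^ t) f))) \<longlonglongrightarrow> c\<^sup>2 * card B + L"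
    unfolding dec sum.distrib distrib_left by (intro tendsto_add)
  with \<open>L \<ge> 0\<close> show ?thesis by (intro exI[of _ "c\<^sup>2 * card B + L"]) simp
qed

end

section \<open>Frozen pairs of full neighbors\<close>

context pair_graph
begin

lemma nbrs_subset_verts: "nbrs G v \<subseteq> pverts G"
  by (auto simp: nbrs_def dest: in_arcsD2)

lemma finite_nbrs: "finite (nbrs G v)"
  using nbrs_subset_verts pair_finite_verts finite_subset by blast

lemma nbrs_sym: "w \<in> nbrs G v \<longleftrightarrow> v \<in> nbrs G w"
  by (auto simp: nbrs_def intro: arcs_symmetric)

lemma not_nbrs_self: "v \<notin> nbrs G v"
  using pair_no_loops[of "(v, v)"] by (auto simp: nbrs_def)

end

definition update_sign :: "'a update \<Rightarrow> 'a \<Rightarrow> int" where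
  "update_sign u x = (if u = Antifire x then 1 else if u = Fire x then - 1 else 0)"

text \<open>An update acts as the graph Laplacian, degree minus adjacency, on the signed indicator
  of its site. Symmetry of adjacency lets the sum run over the neighbors of the affected vertex
  \<open>w\<close>.\<close>

lemma (in pair_graph) increment_eq_laplacian:
  "increment G u w = int (deg G w) * update_sign u w - (\<Sum>x\<in>nbrs G w. update_sign u x)"
proof (cases u)
  case (Fire v)
  have "(\<Sum>x\<in>nbrs G w. update_sign u x) = (\<Sum>x\<in>nbrs G w. if x = v then - 1 else 0)"
    by (intro sum.cong) (auto simp: update_sign_def Fire)
  also have "\<dots> = (if v \<in> nbrs G w then - 1 else 0)"
    by (simp add: finite_nbrs)
  finally show ?thesis
    using not_nbrs_self nbrs_sym[of w v] by (auto simp: Fire update_sign_def)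
next
  case (Antifire v)
  have "(\<Sum>x\<in>nbrs G w. update_sign u x) = (\<Sum>x\<in>nbrs G w. if x = v then 1 else 0)"
    by (intro sum.cong) (auto simp: update_sign_def Antifire)
  also have "\<dots> = (if v \<in> nbrs G w then 1 else 0)"
    by (simp add: finite_nbrs)
  finally show ?thesis
    using not_nbrs_self nbrs_sym[of w v] by (auto simp: Antifire update_sign_def)
qed

lemma apply_single_update:
  "w \<in> pverts G \<Longrightarrow> apply_updates G {u} m w = m w + increment G u w"
  by (simp add: apply_updates_def)

lemma configs_bounds:
  "m \<in> configs G \<Longrightarrow> w \<in> pverts G \<Longrightarrow> 0 \<le> m w \<and> m w \<le> int (deg G w)"
  unfolding configs_def by (drule (1) PiE_mem) simp

section \<open>Paths of allowed single updates\<close>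

locale update_path = pair_graph G
  for G :: "'a pair_pre_digraph" +
  fixes m :: "nat \<Rightarrow> 'a config" and u :: "nat \<Rightarrow> 'a update" and N :: nat
  assumes start: "m 0 \<in> configs G"
    and allowed_update: "i < N \<Longrightarrow> allowed G (m i) (u i)"
    and next_config: "i < N \<Longrightarrow> m (Suc i) = apply_updates G {u i} (m i)"
begin

text \<open>Net number of anti-firings of \<open>x\<close> among the first \<open>t\<close> updates;
  firings count negatively.\<close>

definition count :: "nat \<Rightarrow> 'a \<Rightarrow> int" where
  "count t x = (\<Sum>j<t. update_sign (u j) x)"

lemma count_0 [simp]: "count 0 x = 0"
  by (simp add: count_def)

lemma count_Suc: "count (Suc t) x = count t x + update_sign (u t) x"
  by (simp add: count_def)

lemma path_in_configs: "i \<le> N \<Longrightarrow> m i \<in> configs G"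
proof (cases i)
  case (Suc j)
  assume "i \<le> N"
  with Suc allowed_update[of j] next_config[of j] show ?thesis by (simp add: allowed_def)
qed (simp add: start)

lemmas path_bounds = configs_bounds[OF path_in_configs]

text \<open>By linearity of the Laplacian, the order of the updates does not matter, only their net
  counts.\<close>

lemma path_eq_laplacian:
  assumes "w \<in> pverts G" "i \<le> N"
  shows "m i w = m 0 w + int (deg G w) * count i w - (\<Sum>x\<in>nbrs G w. count i x)"
  using assms(2)
proof (induction i)
  case (Suc i)
  then show ?case
    using assms(1)
    by (simp add: next_config apply_single_update increment_eq_laplacian count_Suc
        sum.distrib algebra_simps)
qed simp

text \<open>An anti-firing raises \<open>y\<close> by the whole width of its admissible range, so it
  can only lead from one end to the other.\<close>

lemma path_Antifire:
  assumes "i < N" "u i = Antifire y"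
  shows "y \<in> pverts G" "m i y = 0" "m (Suc i) y = int (deg G y)"
proof -
  show y: "y \<in> pverts G"
    using allowed_update[OF assms(1)] assms(2) by (simp add: allowed_def)
  have "m (Suc i) y = m i y + int (deg G y)"
    using assms y by (simp add: next_config apply_single_update)
  then show "m i y = 0" "m (Suc i) y = int (deg G y)"
    using path_bounds[of "Suc i" y] path_bounds[of i y] y assms(1) by auto
qed

lemma path_Fire_neighbor:
  assumes "i < N" "u i = Fire y" "c \<in> nbrs G y"
  shows "m i c < int (deg G c)"
proof -
  have c: "c \<in> pverts G" using assms(3) nbrs_subset_verts by blast
  have "c \<noteq> y" using assms(3) not_nbrs_self by blast
  then have "m (Suc i) c = m i c + 1"
    using assms c by (simp add: next_config apply_single_update)
  then show ?thesis
    using path_bounds[of "Suc i" c] c assms(1) by auto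
qed

text \<open>
  A vertex \<open>y\<close> is full right after an anti-firing and empty right before the next one. In between
  its neighbors must anti-fire \<open>deg y\<close> times in total; one neighbor being idle, another one must
  anti-fire twice while \<open>y\<close> is idle, which is the same situation on a shorter time interval.
\<close>

lemma idle_neighbor_count_le:
  assumes "x \<in> nbrs G y" "s \<le> t" "t \<le> N"
    and "\<And>j. s \<le> j \<Longrightarrow> j \<le> t \<Longrightarrow> count j x = count s x"
  shows "count t y \<le> count s y + 1"
  using assms
proof (induction "t - s" arbitrary: s t x y rule: less_induct)
  case less
  show ?case
  proof (rule ccontr)
    assume "\<not> ?thesis"
    then have rise: "count s y + 2 \<le> count t y" by simp
    \<comment> \<open>\<open>r\<close> is the first time at which the net count of \<open>y\<close>
      has risen by two; the update at \<open>q = r - 1\<close> is therefore an anti-firing of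
      \<open>y\<close>.\<close>
    define r where "r = (LEAST j. s \<le> j \<and> count s y + 2 \<le> count j y)"
    have r: "s \<le> r" "count s y + 2 \<le> count r y"
      using LeastI[of "\<lambda>j. s \<le> j \<and> count s y + 2 \<le> count j y" t] rise less.prems(2)
      unfolding r_def by auto
    have "r \<le> t"
      unfolding r_def by (rule Least_le) (use rise less.prems(2) in simp)
    have before_r: "count j y \<le> count s y + 1" if "s \<le> j" "j < r" for j
      using not_less_Least[of j "\<lambda>j. s \<le> j \<and> count s y + 2 \<le> count j y"] that
      unfolding r_def by auto
    have "r \<noteq> s" using r(2) by auto
    then obtain q where q: "r = Suc q" "s \<le> q"
      using r(1) by (cases r) auto
    have sign_le: "update_sign v z \<le> 1" for v :: "'a update" and z
      by (simp add: update_sign_def)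
    have "count q y = count s y + 1" and sign_q: "update_sign (u q) y = 1"
      using before_r[of q] r(2) q sign_le[of "u q" y] by (auto simp: count_Suc)
    \<comment> \<open>\<open>p\<close> is the last time up to \<open>q\<close> at which the count is
      not above its initial level, so the update at \<open>p\<close> is the preceding anti-firing of
      \<open>y\<close>.\<close>
    define p where "p = (GREATEST j. s \<le> j \<and> j \<le> q \<and> count j y \<le> count s y)"
    have p: "s \<le> p" "p \<le> q" "count p y \<le> count s y"
      using GreatestI_nat[of "\<lambda>j. s \<le> j \<and> j \<le> q \<and> count j y \<le> count s y" s q] q(2)
      unfolding p_def by auto
    have after_p: "count j y \<ge> count s y + 1" if "p < j" "j \<le> q" for j
    proof (rule ccontr)
      assume "\<not> ?thesis"
      then have "s \<le> j \<and> j \<le> q \<and> count j y \<le> count s y" using that p(1) by auto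
      then have "j \<le> p"
        unfolding p_def by (intro Greatest_le_nat[of _ j q]) auto
      with that show False by simp
    qed
    have "p \<noteq> q" using p(3) \<open>count q y = count s y + 1\<close> by auto
    then have "p < q" using p(2) by simp
    have sign_p: "update_sign (u p) y = 1"
      using after_p[of "Suc p"] p(3) \<open>p < q\<close> sign_le[of "u p" y] by (auto simp: count_Suc)
    \<comment> \<open>Strictly between the two anti-firings, the integer count is squeezed to
      exactly \<open>count s y + 1\<close>.\<close>
    have idle: "count j y = count (Suc p) y" if "Suc p \<le> j" "j \<le> q" for j
      using after_p[of j] before_r[of j] after_p[of "Suc p"] before_r[of "Suc p"] that p(1) q
      by auto
    have len: "q < N" "p < N" using q \<open>r \<le> t\<close> less.prems(3) \<open>p < q\<close> by auto
    have "u q = Antifire y" "u p = Antifire y"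
      using sign_q sign_p by (auto simp: update_sign_def split: if_splits)
    note full = path_Antifire[OF len(2) this(2)] and empty = path_Antifire[OF len(1) this(1)]
    define d where "d z = count q z - count (Suc p) z" for z
    \<comment> \<open>From time \<open>Suc p\<close> to \<open>q\<close>, \<open>y\<close> drops
      from full to empty without net updates of its own, so its neighbors account for the whole
      drop.\<close>
    have total: "(\<Sum>z\<in>nbrs G y. d z) = int (deg G y)"
      using path_eq_laplacian[OF full(1), of q] path_eq_laplacian[OF full(1), of "Suc p"]
        full(3) empty(2) len \<open>p < q\<close> idle[of q]
      by (simp add: d_def sum_subtractf)
    have "d z \<le> (if z = x then 0 else 1)" if z: "z \<in> nbrs G y" for z
    proof (cases "z = x")
      case True
      then show ?thesis
        using less.prems(4)[of q] less.prems(4)[of "Suc p"] p(1) q \<open>p < q\<close> \<open>r \<le> t\<close>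
        by (simp add: d_def)
    next
      case False
      \<comment> \<open>The roles are exchanged: now \<open>y\<close> is the idle neighbor of
        \<open>z\<close>, on a strictly shorter interval.\<close>
      have "count q z \<le> count (Suc p) z + 1"
      proof (rule less.hyps)
        show "q - Suc p < t - s" using p(1) q \<open>r \<le> t\<close> \<open>p < q\<close> by auto
        show "y \<in> nbrs G z" using z nbrs_sym by blast
        show "Suc p \<le> q" "q \<le> N" using len \<open>p < q\<close> by auto
        show "count j y = count (Suc p) y" if "Suc p \<le> j" "j \<le> q" for j
          using that by (rule idle)
      qed
      then show ?thesis using False by (simp add: d_def)
    qed
    then have "(\<Sum>z\<in>nbrs G y. d z) \<le> (\<Sum>z\<in>nbrs G y. if z = x then 0 else 1)"
      by (rule sum_mono)
    also have "\<dots> = (\<Sum>z\<in>nbrs G y - {x}. 1)"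
      by (rule sum.mono_neutral_cong_right) (auto simp: finite_nbrs)
    also have "\<dots> < int (deg G y)"
      using less.prems(1) finite_nbrs[of y] card_Diff1_less[of "nbrs G y" x]
      by (simp add: deg_def)
    finally show False using total by simp
  qed
qed

text \<open>Induction on time, for all vertices of the set at once: while all of them are idle, the
  centers \<open>v\<close> and \<open>w\<close> stay full, and this together with the bound for
  neighbors of idle vertices blocks the next update on the set.\<close>

lemma full_pair_frozen:
  assumes w: "w \<in> nbrs G v"
    and full: "\<And>x. x \<in> nbrs G v \<union> nbrs G w \<Longrightarrow> m 0 x = int (deg G x)"
    and "i \<le> N" "x \<in> nbrs G v \<union> nbrs G w"
  shows "count i x = 0"
proof -
  let ?F = "nbrs G v \<union> nbrs G w"
  have "\<forall>j\<le>i. \<forall>x\<in>?F. count j x = 0"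
    using \<open>i \<le> N\<close>
  proof (induction i)
    case (Suc i)
    then have i: "i < N" and idle: "\<And>j x. j \<le> i \<Longrightarrow> x \<in> ?F \<Longrightarrow> count j x = 0" by auto
    \<comment> \<open>A center and all its neighbors belong to the set, so every count entering its
      value is zero.\<close>
    have center: "m i c = int (deg G c)" if "c \<in> {v, w}" for c
    proof -
      have "c \<in> ?F" "nbrs G c \<subseteq> ?F" using that w nbrs_sym by auto
      moreover from this have "c \<in> pverts G" using nbrs_subset_verts by blast
      ultimately show ?thesis
        using path_eq_laplacian[of c i] i full idle[of i] by (auto intro!: sum.neutral)
    qed
    have "update_sign (u i) y = 0" if y: "y \<in> ?F" for y
    proof -
      obtain c where c: "c \<in> {v, w}" "c \<in> nbrs G y" "c \<in> ?F"
        using y w nbrs_sym by auto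
      have "u i \<noteq> Fire y"
        using path_Fire_neighbor[OF i _ c(2)] center[OF c(1)] by force
      moreover have "u i \<noteq> Antifire y"
      proof
        assume u: "u i = Antifire y"
        have yv: "y \<in> pverts G" using y nbrs_subset_verts by blast
        have "count i z \<le> (if z = c then 0 else 1)" if z: "z \<in> nbrs G y" for z
        proof (cases "z = c")
          case True
          then show ?thesis using idle[of i] c(3) by simp
        next
          case False
          \<comment> \<open>Here \<open>y\<close> is the idle neighbor of \<open>z\<close>
            throughout the interval from 0 to \<open>i\<close>. As \<open>c\<close> contributes
            nothing, the neighbors of \<open>y\<close> total at most \<open>deg G y - 1\<close>, too
            few to empty it.\<close>
          have "count i z \<le> count 0 z + 1"
            by (rule idle_neighbor_count_le[of y]) (use z nbrs_sym i idle y in auto)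
          then show ?thesis using False by simp
        qed
        then have "(\<Sum>z\<in>nbrs G y. count i z) \<le> (\<Sum>z\<in>nbrs G y. if z = c then 0 else 1)"
          by (rule sum_mono)
        also have "\<dots> = (\<Sum>z\<in>nbrs G y - {c}. 1)"
          by (rule sum.mono_neutral_cong_right) (auto simp: finite_nbrs)
        also have "\<dots> < int (deg G y)"
          using c(2) finite_nbrs[of y] card_Diff1_less[of "nbrs G y" c] by (simp add: deg_def)
        finally have "m i y > 0"
          using path_eq_laplacian[OF yv, of i] i full[OF y] idle[of i y] y by simp
        then show False using path_Antifire(2)[OF i u] by simp
      qed
      ultimately show ?thesis by (simp add: update_sign_def)
    qed
    then show ?case using idle by (auto simp: le_Suc_eq count_Suc)
  qed simp
  then show ?thesis using assms(4) by blast
qed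

lemma full_pair_center:
  assumes w: "w \<in> nbrs G v"
    and full: "\<And>x. x \<in> nbrs G v \<union> nbrs G w \<Longrightarrow> m 0 x = int (deg G x)"
    and "i \<le> N"
  shows "m i v = int (deg G v)"
proof -
  have v: "v \<in> nbrs G w" using w nbrs_sym by blast
  then have "v \<in> pverts G" using nbrs_subset_verts by blast
  then show ?thesis
    using path_eq_laplacian[of v i] full_pair_frozen[OF w full] full[of v] v \<open>i \<le> N\<close> by simp
qed

end

section \<open>The component of a full pair\<close>

text \<open>Elementary moves independent of the chain; any transition of a chain is a composition of
  them.\<close>

definition update_steps :: "'a pair_pre_digraph \<Rightarrow> 'a config rel" where
  "update_steps G = {(m, apply_updates G {u} m) | m u. allowed G m u}"

lemma (in pair_graph) reachable_from_full_pair: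
  assumes reach: "(m, m') \<in> (update_steps G)\<^sup>*" and m: "m \<in> configs G"
    and w: "w \<in> nbrs G v"
    and full: "\<And>x. x \<in> nbrs G v \<union> nbrs G w \<Longrightarrow> m x = int (deg G x)"
  shows "m' v = int (deg G v)"
proof -
  obtain N where "(m, m') \<in> update_steps G ^^ N" using reach by (auto simp: rtrancl_power)
  then obtain f where f: "f 0 = m" "f N = m'" "\<And>i. i < N \<Longrightarrow> (f i, f (Suc i)) \<in> update_steps G"
    by (auto simp: relpow_fun_conv)
  \<comment> \<open>The implication inside the existential lets choice produce a total sequence
    \<open>u\<close>, arbitrary from \<open>N\<close> on.\<close>
  have "\<exists>u. i < N \<longrightarrow> allowed G (f i) u \<and> f (Suc i) = apply_updates G {u} (f i)" for i
    using f(3)[of i] by (auto simp: update_steps_def)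
  then obtain u where u: "\<And>i. i < N \<Longrightarrow> allowed G (f i) (u i) \<and> f (Suc i) = apply_updates G {u i} (f i)"
    by metis
  interpret update_path G f u N
    by unfold_locales (use f(1) m u in auto)
  show ?thesis
    using full_pair_center[OF w, of N] full f(1,2) by simp
qed

lemma increment_outside_support: "w \<notin> support G u \<Longrightarrow> increment G u w = 0"
  by (cases u) (auto simp: support_def)

lemma (in pair_graph) finite_allowed_collection:
  assumes "allowed_collection G m S"
  shows "finite S"
proof (rule finite_subset)
  show "S \<subseteq> Fire ` pverts G \<union> Antifire ` pverts G"
  proof
    fix u assume "u \<in> S"
    then have "site u \<in> pverts G" using assms by (simp add: allowed_collection_def allowed_def)
    then show "u \<in> Fire ` pverts G \<union> Antifire ` pverts G" by (cases u) auto
  qed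
qed (simp add: pair_finite_verts)

text \<open>
  Updates with disjoint supports can be applied one after the other, each of them staying allowed.
\<close>

lemma (in pair_graph) allowed_collection_reachable:
  assumes "allowed_collection G m S" "m \<in> configs G"
  shows "(m, apply_updates G S m) \<in> (update_steps G)\<^sup>* \<and> apply_updates G S m \<in> configs G"
proof -
  have "finite S" using assms(1) by (rule finite_allowed_collection)
  then show ?thesis
    using assms(1)
  proof (induction S)
    case empty
    have "apply_updates G {} m = m"
      using assms(2) by (auto simp: apply_updates_def configs_def PiE_iff extensional_restrict)
    then show ?case using assms(2) by simp
  next
    case (insert u S)
    let ?m = "apply_updates G S m"
    have "allowed_collection G m S"
      using insert.prems unfolding allowed_collection_def
      by (auto intro: disjoint_family_on_mono)
    then have IH: "(m, ?m) \<in> (update_steps G)\<^sup>*" "?m \<in> configs G"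
      using insert.IH by auto
    have u: "allowed G m u" using insert.prems by (simp add: allowed_collection_def)
    have split: "apply_updates G (insert u S) m = apply_updates G {u} ?m"
      using insert.hyps by (auto simp: apply_updates_def fun_eq_iff)
    \<comment> \<open>On the support of \<open>u\<close> the other updates do nothing, so the value
      is that of \<open>u\<close> applied to \<open>m\<close>; elsewhere \<open>u\<close> does
      nothing.\<close>
    have "apply_updates G {u} ?m w \<in> {0..int (deg G w)}" if w: "w \<in> pverts G" for w
    proof (cases "w \<in> support G u")
      case True
      have "increment G u' w = 0" if "u' \<in> S" for u'
      proof -
        have "u \<noteq> u'" using that insert.hyps by auto
        then have "support G u \<inter> support G u' = {}"
          using insert.prems that unfolding allowed_collection_def disjoint_family_on_def by auto
        with True show ?thesis by (intro increment_outside_support) auto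
      qed
      then have "apply_updates G {u} ?m w = apply_updates G {u} m w"
        using w by (simp add: apply_updates_def)
      then show ?thesis
        using u w configs_bounds[of "apply_updates G {u} m" G w] by (simp add: allowed_def)
    next
      case False
      then have "apply_updates G {u} ?m w = ?m w"
        using w by (simp add: apply_single_update increment_outside_support)
      then show ?thesis using IH(2) w configs_bounds[of ?m G w] by simp
    qed
    then have "apply_updates G {u} ?m \<in> configs G"
      unfolding configs_def by (intro PiE_I) (auto simp: apply_updates_def)
    with u have "allowed G ?m u" by (simp add: allowed_def)
    then have "(?m, apply_updates G {u} ?m) \<in> update_steps G"
      by (auto simp: update_steps_def)
    with IH(1) \<open>apply_updates G {u} ?m \<in> configs G\<close> show ?case
      unfolding split by (auto intro: rtrancl_into_rtrancl)
  qed
qed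

section \<open>Counting configurations\<close>

context pair_graph
begin

lemma finite_configs: "finite (configs G)"
  unfolding configs_def by (intro finite_PiE pair_finite_verts) simp

lemma num_configs_pos: "num_configs G > 0"
  by (simp add: num_configs_def pair_finite_verts)

text \<open>The involution replacing \<open>m v\<close> by \<open>deg G v - m v\<close> preserves
  the configurations, so the mean is the midpoint.\<close>

lemma sum_configs_at:
  assumes v: "v \<in> pverts G"
  shows "(\<Sum>m\<in>configs G. real_of_int (m v)) = real (num_configs G) * (real (deg G v) / 2)"
proof -
  let ?flip = "\<lambda>m. m(v := int (deg G v) - m v)"
  have flip: "?flip m \<in> configs G" if "m \<in> configs G" for m
    using that v unfolding configs_def by (auto simp: PiE_iff extensional_def)
  have "(\<Sum>m\<in>configs G. real_of_int (m v)) = (\<Sum>m\<in>configs G. real (deg G v) - real_of_int (m v))"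
    by (rule sum.reindex_bij_witness[of _ ?flip ?flip]) (auto simp: flip)
  then show ?thesis
    using card_configs[OF pair_graph_axioms] by (simp add: sum_subtractf)
qed

text \<open>Configurations form a product, in which each factor over \<open>F\<close> shrinks to a
  single value. The multiplicative form avoids division of natural numbers.\<close>

lemma card_configs_full_on:
  assumes "F \<subseteq> pverts G"
  shows "card {m \<in> configs G. \<forall>x\<in>F. m x = int (deg G x)} * (\<Prod>x\<in>F. deg G x + 1) = num_configs G"
proof -
  let ?r = "\<lambda>x. if x \<in> F then {int (deg G x)} else {0..int (deg G x)}"
  have r_iff: "k \<in> ?r x \<longleftrightarrow> k \<in> {0..int (deg G x)} \<and> (x \<in> F \<longrightarrow> k = int (deg G x))" for k x
    by auto
  have "m \<in> {m \<in> configs G. \<forall>x\<in>F. m x = int (deg G x)} \<longleftrightarrow> m \<in> (\<Pi>\<^sub>E x\<in>pverts G. ?r x)" for m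
    unfolding mem_Collect_eq configs_def PiE_iff r_iff using assms by blast
  then have "{m \<in> configs G. \<forall>x\<in>F. m x = int (deg G x)} = (\<Pi>\<^sub>E x\<in>pverts G. ?r x)"
    by blast
  then have "card {m \<in> configs G. \<forall>x\<in>F. m x = int (deg G x)} = (\<Prod>x\<in>pverts G. card (?r x))"
    by (simp add: card_PiE pair_finite_verts)
  also have "\<dots> = (\<Prod>x\<in>pverts G - F. deg G x + 1)"
    by (rule prod.mono_neutral_cong_right) (auto simp: pair_finite_verts)
  finally show ?thesis
    unfolding num_configs_def using prod.subset_diff[OF assms pair_finite_verts] by metis
qed

text \<open>Source of the exponent: two neighborhoods have at most \<open>2 * z0\<close> vertices in
  total, each with at most \<open>z0 + 1\<close> values.\<close>

lemma prod_deg_pair_le: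
  assumes "\<forall>x\<in>pverts G. deg G x \<le> z0" "v \<in> pverts G" "w \<in> nbrs G v"
  shows "(\<Prod>x\<in>nbrs G v \<union> nbrs G w. deg G x + 1) \<le> (z0 + 1) ^ (2 * z0)"
proof -
  let ?F = "nbrs G v \<union> nbrs G w"
  have "w \<in> pverts G" using assms(3) nbrs_subset_verts by blast
  then have "deg G v \<le> z0" "deg G w \<le> z0" using assms(1,2) by auto
  then have "card ?F \<le> 2 * z0"
    using card_Un_le[of "nbrs G v" "nbrs G w"] by (simp add: deg_def)
  have "(\<Prod>x\<in>?F. deg G x + 1) \<le> (\<Prod>x\<in>?F. z0 + 1)"
    using assms(1) nbrs_subset_verts by (intro prod_mono) auto
  also have "\<dots> \<le> (z0 + 1) ^ (2 * z0)"
    using \<open>card ?F \<le> 2 * z0\<close> by (simp add: power_increasing)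
  finally show ?thesis .
qed

end

section \<open>Autocorrelations\<close>

context laplacian_chain
begin

lemma transition_reachable:
  assumes "m \<in> configs G" "m' \<in> set_pmf (T m)"
  shows "(m, m') \<in> (update_steps G)\<^sup>*" "m' \<in> configs G"
proof -
  obtain S where "allowed_collection G m S" "m' = apply_updates G S m"
    using random_updates[OF assms(1)] assms(2) by fastforce
  then show "(m, m') \<in> (update_steps G)\<^sup>*" "m' \<in> configs G"
    using allowed_collection_reachable assms(1) by auto
qed

sublocale kernel: symmetric_kernel "configs G" "\<lambda>m m'. pmf (T m) m'"
proof
  show "finite (configs G)" by (rule finite_configs)
  show "(\<Sum>m'\<in>configs G. pmf (T m) m') = 1" if "m \<in> configs G" for m
    using that transition_reachable(2) by (intro sum_pmf_eq_1 finite_configs) auto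
qed (auto simp: reversible)

lemma law_in_configs: "m \<in> configs G \<Longrightarrow> set_pmf (law T t m) \<subseteq> configs G"
proof (induction t)
  case (Suc t)
  then show ?case using transition_reachable(2) by fastforce
qed simp

text \<open>\<open>law\<close> appends the newest step at the end, so averaging over that step turns
  \<open>g\<close> into \<open>evolve g\<close>; hence the induction with \<open>g\<close>
  arbitrary.\<close>

lemma expectation_law:
  fixes g :: "'a config \<Rightarrow> real"
  assumes "m \<in> configs G"
  shows "measure_pmf.expectation (law T t m) g = (kernel.evolve ^^ t) g m"
proof (induction t arbitrary: g)
  case (Suc t)
  have one_step: "measure_pmf.expectation (T a) g = kernel.evolve g a" if "a \<in> configs G" for a
    unfolding kernel.evolve_def using transition_reachable(2)[OF that]
    by (subst integral_measure_pmf[OF finite_configs]) auto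
  have "measure_pmf.expectation (law T (Suc t) m) g =
      (\<Sum>a\<in>configs G. pmf (law T t m) a *\<^sub>R measure_pmf.expectation (T a) g)"
    unfolding law.simps
  proof (rule pmf_expectation_bind[OF finite_configs _ law_in_configs[OF assms]])
    show "finite (set_pmf (T a))" if "a \<in> configs G" for a
      using transition_reachable(2)[OF that] finite_configs by (meson finite_subset subsetI)
  qed
  also have "\<dots> = (\<Sum>a\<in>configs G. pmf (law T t m) a *\<^sub>R kernel.evolve g a)"
    by (intro sum.cong refl) (simp add: one_step)
  also have "\<dots> = measure_pmf.expectation (law T t m) (kernel.evolve g)"
    using law_in_configs[OF assms] by (intro integral_measure_pmf[OF finite_configs, symmetric]) auto
  also have "\<dots> = (kernel.evolve ^^ Suc t) g m"
    unfolding Suc.IH by (simp add: funpow_swap1)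
  finally show ?case .
qed simp

text \<open>By stationarity both means equal \<open>deg G v / 2\<close> at every time, so the
  connected correlation is the plain correlation of the centered observable.\<close>

lemma autocorr_eq_ip:
  fixes v :: 'a
  assumes v: "v \<in> pverts G"
  defines "f \<equiv> \<lambda>m. real_of_int (m v) - real (deg G v) / 2"
  shows "autocorr G T v t = 1 / real (num_configs G) * kernel.ip f ((kernel.evolve ^^ t) f)"
proof -
  define D where "D = real (num_configs G)"
  define c where "c = real (deg G v) / 2"
  define g where "g = (\<lambda>m :: 'a config. real_of_int (m v))"
  define h where "h = (kernel.evolve ^^ t) g"
  have "D > 0" using num_configs_pos by (simp add: D_def)
  have cardD: "real (card (configs G)) = D"
    using card_configs[OF pair_graph_axioms] by (simp add: D_def)
  have sum_g: "(\<Sum>m\<in>configs G. g m) = D * c"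
    using sum_configs_at[OF v] by (simp add: g_def D_def c_def)
  have sum_h: "(\<Sum>m\<in>configs G. h m) = D * c"
    unfolding h_def using kernel.sum_evolve_power sum_g by simp
  have mean: "mean_at T v t m = h m" if "m \<in> configs G" for m
    unfolding mean_at_def h_def g_def using expectation_law[OF that] by simp
  have "kernel.ip f ((kernel.evolve ^^ t) f) = (\<Sum>m\<in>configs G. (g m - c) * (h m - c))"
    unfolding kernel.ip_def f_def h_def
    by (intro sum.cong refl) (simp add: kernel.evolve_power_minus_const g_def c_def)
  also have "\<dots> = (\<Sum>m\<in>configs G. g m * h m) - c * (\<Sum>m\<in>configs G. h m)
      - c * (\<Sum>m\<in>configs G. g m) + c * c * D"
    by (simp add: algebra_simps sum.distrib sum_subtractf sum_distrib_left cardD[symmetric])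
  also have "\<dots> = (\<Sum>m\<in>configs G. g m * h m) - D * c * c"
    unfolding sum_g sum_h by (simp add: algebra_simps)
  finally have ip: "kernel.ip f ((kernel.evolve ^^ t) f) = (\<Sum>m\<in>configs G. g m * h m) - D * c * c" .
  have "autocorr G T v t = 1 / D * (\<Sum>m\<in>configs G. g m * h m)
      - (1 / D * (\<Sum>m\<in>configs G. g m)) * (1 / D * (\<Sum>m\<in>configs G. h m))"
    unfolding autocorr_def D_def[symmetric] using mean by (simp add: g_def)
  also have "\<dots> = 1 / D * ((\<Sum>m\<in>configs G. g m * h m) - D * c * c)"
    unfolding sum_g sum_h using \<open>D > 0\<close> by (simp add: field_simps)
  finally show ?thesis unfolding ip D_def .
qed

text \<open>\<open>B\<close> collects everything reachable from the configurations \<open>A\<close>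
  that are full around an edge at \<open>v\<close>. Reachability makes it closed, freezing keeps
  \<open>v\<close> full, and \<open>A\<close> alone already gives the size.\<close>

lemma closed_set_with_fixed_value:
  assumes deg_le: "\<forall>x\<in>pverts G. deg G x \<le> z0" and v: "v \<in> pverts G" and "deg G v \<noteq> 0"
  obtains B where "B \<subseteq> configs G"
    "\<And>m m'. m \<in> B \<Longrightarrow> m' \<in> configs G - B \<Longrightarrow> pmf (T m) m' = 0"
    "\<And>m. m \<in> B \<Longrightarrow> m v = int (deg G v)"
    "num_configs G \<le> card B * (z0 + 1) ^ (2 * z0)"
proof -
  have "nbrs G v \<noteq> {}" using \<open>deg G v \<noteq> 0\<close> by (auto simp: deg_def)
  then obtain w where w: "w \<in> nbrs G v" by blast
  let ?F = "nbrs G v \<union> nbrs G w"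
  define A where "A = {m \<in> configs G. \<forall>x\<in>?F. m x = int (deg G x)}"
  define B where "B = (update_steps G)\<^sup>* `` A \<inter> configs G"
  have "pmf (T m) m' = 0" if "m \<in> B" "m' \<in> configs G - B" for m m'
  proof (rule ccontr)
    assume "pmf (T m) m' \<noteq> 0"
    then have "(m, m') \<in> (update_steps G)\<^sup>*"
      using that(1) transition_reachable(1)[of m m'] by (simp add: B_def set_pmf_iff)
    with that show False unfolding B_def by (auto intro: rtrancl_trans)
  qed
  moreover have "m v = int (deg G v)" if "m \<in> B" for m
    using that reachable_from_full_pair[OF _ _ w] unfolding A_def B_def by blast
  moreover have "num_configs G \<le> card B * (z0 + 1) ^ (2 * z0)"
  proof -
    have "A \<subseteq> B" by (auto simp: A_def B_def)
    moreover have "finite B" using finite_configs by (simp add: B_def)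
    ultimately have "card A \<le> card B" by (rule card_mono[rotated])
    have "num_configs G = card A * (\<Prod>x\<in>?F. deg G x + 1)"
      unfolding A_def using nbrs_subset_verts by (intro card_configs_full_on[symmetric]) auto
    also have "\<dots> \<le> card B * (z0 + 1) ^ (2 * z0)"
      using \<open>card A \<le> card B\<close> prod_deg_pair_le[OF deg_le v w] by (rule mult_le_mono)
    finally show ?thesis .
  qed
  moreover have "B \<subseteq> configs G" by (simp add: B_def)
  ultimately show thesis using that[of B] by blast
qed

lemma autocorr_avg_tendsto:
  assumes deg_le: "\<forall>x\<in>pverts G. deg G x \<le> z0" and v: "v \<in> pverts G"
  shows "\<exists>L \<ge> (real (deg G v) / 2)\<^sup>2 * (real z0 + 1) powi (- 2 * int z0). autocorr_avg G T v \<longlonglongrightarrow> L"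
proof -
  define f where "f m = real_of_int (m v) - real (deg G v) / 2" for m :: "'a config"
  define c where "c = real (deg G v) / 2"
  define D where "D = real (num_configs G)"
  define P where "P = (real z0 + 1) ^ (2 * z0)"
  have "D > 0" using num_configs_pos by (simp add: D_def)
  have "P > 0" by (simp add: P_def)
  have powi: "(real z0 + 1) powi (- 2 * int z0) = 1 / P"
  proof -
    have "(real z0 + 1) powi (- int (2 * z0)) = 1 / P"
      unfolding P_def power_int_minus power_int_of_nat by (simp add: divide_inverse)
    then show ?thesis by simp
  qed
  obtain B where B: "B \<subseteq> configs G" "\<And>m m'. m \<in> B \<Longrightarrow> m' \<in> configs G - B \<Longrightarrow> pmf (T m) m' = 0"
    "\<And>m. m \<in> B \<Longrightarrow> f m = c" "c\<^sup>2 * (D / P) \<le> c\<^sup>2 * card B"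
  proof (cases "deg G v = 0")
    \<comment> \<open>For an isolated vertex \<open>c = 0\<close>, so the required bound is zero and
      the empty set serves.\<close>
    case True
    then show ?thesis using that[of "{}"] by (simp add: c_def)
  next
    case False
    then obtain B where B: "B \<subseteq> configs G"
      "\<And>m m'. m \<in> B \<Longrightarrow> m' \<in> configs G - B \<Longrightarrow> pmf (T m) m' = 0"
      "\<And>m. m \<in> B \<Longrightarrow> m v = int (deg G v)" "num_configs G \<le> card B * (z0 + 1) ^ (2 * z0)"
      using closed_set_with_fixed_value[OF deg_le v] by metis
    have "D \<le> real (card B * (z0 + 1) ^ (2 * z0))"
      unfolding D_def using B(4) by (rule of_nat_mono)
    also have "\<dots> = card B * P" by (simp add: P_def add.commute)
    finally have "D / P \<le> card B" using \<open>P > 0\<close> by (simp add: field_simps)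
    then have "c\<^sup>2 * (D / P) \<le> c\<^sup>2 * card B" by (rule mult_left_mono) simp
    moreover have "f m = c" if "m \<in> B" for m
      using B(3)[OF that] by (simp add: f_def c_def)
    ultimately show ?thesis using that B(1,2) by blast
  qed
  obtain L where L: "L \<ge> c\<^sup>2 * card B"
    "(\<lambda>n. 1 / real n * (\<Sum>t=0..n. kernel.ip f ((kernel.evolve ^^ t) f))) \<longlonglongrightarrow> L"
    using kernel.average_autocorrelation_closed_set[of B f c] B(1-3) by blast
  have avg: "autocorr_avg G T v = (\<lambda>n. 1 / D * (1 / real n * (\<Sum>t=0..n. kernel.ip f ((kernel.evolve ^^ t) f))))"
    unfolding autocorr_avg_def autocorr_eq_ip[OF v] f_def[abs_def] D_def
    by (simp add: sum_divide_distrib[symmetric] fun_eq_iff)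
  have "autocorr_avg G T v \<longlonglongrightarrow> 1 / D * L"
    unfolding avg by (rule tendsto_mult[OF tendsto_const L(2)])
  moreover have "c\<^sup>2 * (1 / P) \<le> 1 / D * L"
    using B(4) L(1) \<open>D > 0\<close> by (simp add: field_simps)
  ultimately show ?thesis unfolding powi c_def by blast
qed

end

section \<open>Lower bound and its uniformity over graphs of bounded degree\<close>

theorem theorem1:
  "(\<forall>(G :: 'a pair_pre_digraph) T (z0 :: nat) v.
      laplacian_chain G T \<and> (\<forall>w\<in>pverts G. deg G w \<le> z0) \<and> v \<in> pverts G \<longrightarrow>
        convergent (autocorr_avg G T v) \<and>
        time_avg_autocorr G T v
          \<ge> (real (deg G v) / 2)\<^sup>2 * (real z0 + 1) powi (- 2 * int z0)) \<and>
   (\<forall>z0 :: nat. \<exists>c > 0. \<forall>(G :: 'a pair_pre_digraph) T v.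
      laplacian_chain G T \<and> (\<forall>w\<in>pverts G. deg G w \<le> z0) \<and> v \<in> pverts G \<and> deg G v \<ge> 1 \<longrightarrow>
        time_avg_autocorr G T v \<ge> c)"
proof -
  have main: "convergent (autocorr_avg G T v) \<and>
      (real (deg G v) / 2)\<^sup>2 * (real z0 + 1) powi (- 2 * int z0) \<le> time_avg_autocorr G T v"
    if chain: "laplacian_chain G T" "\<forall>w\<in>pverts G. deg G w \<le> z0" "v \<in> pverts G"
    for G :: "'a pair_pre_digraph" and T z0 v
  proof -
    obtain L where "L \<ge> (real (deg G v) / 2)\<^sup>2 * (real z0 + 1) powi (- 2 * int z0)"
      "autocorr_avg G T v \<longlonglongrightarrow> L"
      using laplacian_chain.autocorr_avg_tendsto[OF chain] by blast
    \<comment> \<open>\<open>lim\<close> is total; the convergence just obtained makes it the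
      genuine limit.\<close>
    then show ?thesis by (auto simp: time_avg_autocorr_def convergentI limI)
  qed
  have "\<exists>c>0. \<forall>(G :: 'a pair_pre_digraph) T v.
      laplacian_chain G T \<and> (\<forall>w\<in>pverts G. deg G w \<le> z0) \<and> v \<in> pverts G \<and> deg G v \<ge> 1 \<longrightarrow>
        time_avg_autocorr G T v \<ge> c" for z0
  \<comment> \<open>The witness is the bound at degree one, the smallest positive degree.\<close>
  proof (intro exI[of _ "(1 / 2)\<^sup>2 * (real z0 + 1) powi (- 2 * int z0)"] conjI allI impI)
    show "0 < (1 / 2)\<^sup>2 * (real z0 + 1) powi (- 2 * int z0)"
      by (intro mult_pos_pos zero_less_power_int) simp_all
    fix G :: "'a pair_pre_digraph" and T v
    assume *: "laplacian_chain G T \<and> (\<forall>w\<in>pverts G. deg G w \<le> z0) \<and> v \<in> pverts G \<and> deg G v \<ge> 1"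
    have "(1 / 2)\<^sup>2 * (real z0 + 1) powi (- 2 * int z0)
        \<le> (real (deg G v) / 2)\<^sup>2 * (real z0 + 1) powi (- 2 * int z0)"
      using * by (intro mult_right_mono power_mono zero_le_power_int) simp_all
    also have "\<dots> \<le> time_avg_autocorr G T v"
      using main[of G T z0 v] * by blast
    finally show "(1 / 2)\<^sup>2 * (real z0 + 1) powi (- 2 * int z0) \<le> time_avg_autocorr G T v" .
  qed
  with main show ?thesis by blast
qed

end
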